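(* Let $1\le p<2$, $r\ge4$, and $\gamma=1/(2-p)$. There are a constant $K(p)$ depending only on $p$ and a universal constant $K$ such that the following holds. Let $T\subset\mathbb R^N$ and assume that $T\subset U+B_{p,\infty}$, where $U\subset\mathbb R^N$ satisfies $\gamma_{1/2}(U)\le1$. Then one can find an increasing family of partitions $(\mathcal C_i)_{i\ge0}$ of $T$ and a probability measure $\mu$ on $T$ such that, for each $i\ge 0$ and each $C\in\mathcal C_i$, the diameter of $C$ for $d_i$ is $\le K(p)r^{-i}$, and $$\forall x\in T,\quad\sum_{i\ge0}r^{-i}\Big(\log\frac1{\mu(C_i(x))}\Big)^{1/2}\le K .$$
   Context: $\lambda$ is the counting measure on $\{1,\dots,N\}$, functions on this set being identified with elements of $\mathbb R^N$. For $i\ge0$, $$d_i(f,g)=\Big(\int\min\big((f-g)^2,r^{-4\gamma i}\big)d\lambda\Big)^{1/2},\qquad B_{p,\infty}=\{f:\ \sup_{t\ge0}t^p\lambda(\{|f|\ge t\})\le1\}.$$ $C_i(x)$ is the element of $\mathcal C_i$ containing $x$. $\gamma_{1/2}(U)=\inf_\mu\sup_{x\in U}\int_0^\infty\sqrt{\log\frac1{\mu(B(x,\varepsilon))}}\,d\varepsilon$, with $B(x,\varepsilon)$ the closed ball for the $L^2(\lambda)$ (Euclidean) distance and the infimum over probability measures on $U$ (equivalently, supported by a countable set). *)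

theory Defs
  imports "HOL-Probability.Probability"
begin

text \<open>
  The space \<open>\<real>\<^sup>N\<close> is represented by the extensional functions on \<open>{1..N}\<close>, so that \<open>N\<close> is an
  ordinary natural number and constants can be asserted to be independent of it.
\<close>

abbreviation RN :: "nat \<Rightarrow> (nat \<Rightarrow> real) set" where
  "RN N \<equiv> {1..N} \<rightarrow>\<^sub>E UNIV"

abbreviation counting :: "nat \<Rightarrow> nat measure" where
  "counting N \<equiv> count_space {1..N}"

definition trunc_dist ::
  "nat \<Rightarrow> real \<Rightarrow> real \<Rightarrow> nat \<Rightarrow> (nat \<Rightarrow> real) \<Rightarrow> (nat \<Rightarrow> real) \<Rightarrow> real" where
  "trunc_dist N r \<gamma> i f g =
     sqrt (\<integral>k. min ((f k - g k)\<^sup>2) (r powr (- 4 * \<gamma> * real i)) \<partial>counting N)"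

definition trunc_diam ::
  "nat \<Rightarrow> real \<Rightarrow> real \<Rightarrow> nat \<Rightarrow> (nat \<Rightarrow> real) set \<Rightarrow> ennreal" where
  "trunc_diam N r \<gamma> i C = (SUP f\<in>C. SUP g\<in>C. ennreal (trunc_dist N r \<gamma> i f g))"

definition weak_Lp_ball :: "nat \<Rightarrow> real \<Rightarrow> (nat \<Rightarrow> real) set" where
  "weak_Lp_ball N p =
     {f \<in> RN N. (SUP t\<in>{0..}. ennreal (t powr p) *
                   emeasure (counting N) {k\<in>{1..N}. t \<le> \<bar>f k\<bar>}) \<le> 1}"

definition set_sum ::
  "nat \<Rightarrow> (nat \<Rightarrow> real) set \<Rightarrow> (nat \<Rightarrow> real) set \<Rightarrow> (nat \<Rightarrow> real) set" where
  "set_sum N A B = {(\<lambda>k\<in>{1..N}. a k + b k) | a b. a \<in> A \<and> b \<in> B}"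

text \<open>
  A probability measure on a subset \<open>A\<close> of \<open>\<real>\<^sup>N\<close>: all Borel subsets of \<open>A\<close> (in the subspace
  sense, \<open>A\<close> itself need not be Borel) are measurable, but the \<open>\<sigma>\<close>-algebra may be larger.
  Thus Borel measures and discrete measures defined on all subsets of \<open>A\<close> are both included.
\<close>

definition prob_measure_on :: "nat \<Rightarrow> (nat \<Rightarrow> real) set \<Rightarrow> (nat \<Rightarrow> real) measure \<Rightarrow> bool" where
  "prob_measure_on N A M \<longleftrightarrow>
     prob_space M \<and> space M = A \<and>
     sets (restrict_space (PiM {1..N} (\<lambda>_. borel)) A) \<subseteq> sets M"

text \<open>The quantity \<open>(log (1 / a))\<^sup>1\<^sup>/\<^sup>2\<close> for \<open>0 \<le> a \<le> 1\<close>, equal to \<open>\<infinity>\<close> at \<open>a = 0\<close>.\<close>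

definition sqrt_log_inv :: "real \<Rightarrow> ennreal" where
  "sqrt_log_inv a = (if a = 0 then \<infinity> else ennreal (sqrt (ln (1 / a))))"

definition gamma_half :: "nat \<Rightarrow> (nat \<Rightarrow> real) set \<Rightarrow> ennreal" where
  "gamma_half N U =
     (INF M\<in>{M. prob_measure_on N U M}. SUP x\<in>U.
        \<integral>\<^sup>+\<epsilon>\<in>{0..}. sqrt_log_inv (measure M {y\<in>U. L2_set (\<lambda>k. x k - y k) {1..N} \<le> \<epsilon>}) \<partial>lborel)"

definition increasing_partitions :: "'a set \<Rightarrow> (nat \<Rightarrow> 'a set set) \<Rightarrow> bool" where
  "increasing_partitions T \<C> \<longleftrightarrow>
     (\<forall>i. partition_on T (\<C> i)) \<and> (\<forall>i. refines T (\<C> (Suc i)) (\<C> i))"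

definition cell :: "'a set set \<Rightarrow> 'a \<Rightarrow> 'a set" where
  "cell P x = (THE C. C \<in> P \<and> x \<in> C)"

end

theory Submission
  imports Defs
begin

text \<open>
  Write each \<open>f \<in> T\<close> as \<open>u + v\<close> with \<open>u \<in> U\<close> and \<open>v\<close> in the weak ball. Since
  \<open>\<integral> min (v\<^sup>2, s\<^sup>2)\<close> is at most a constant times \<open>s\<^sup>2\<^sup>-\<^sup>p\<close>, which for \<open>s = r\<^sup>-\<^sup>2\<^sup>\<gamma>\<^sup>i\<close> is \<open>r\<^sup>-\<^sup>2\<^sup>i\<close>,
  the component \<open>v\<close> never affects the \<open>d\<^sub>i\<close>-diameter by more than \<open>K(p) r\<^sup>-\<^sup>i\<close>, and it suffices to
  partition according to \<open>u\<close>. A near-optimal measure for \<open>U\<close> gives, by a packing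
  argument at each scale \<open>r\<^sup>-\<^sup>i\<close>, a labelling of \<open>U\<close> by centres and a probability on the labels
  charging the label of \<open>x\<close> at least like the square of the measure of the ball \<open>B(x, r\<^sup>-\<^sup>i)\<close>.
  Common refinements of the label partitions, with product weights, cost only a constant factor
  because the scales decrease geometrically.
\<close>

section \<open>Atoms of discrete mixtures, packings and weighted centres\<close>

text \<open>The mass of the mixture at \<open>y\<close> is the average of \<open>pmf (f z) y\<close>
  over \<open>z\<close>; only the contribution of \<open>z = x\<close> is kept. All later lower
  bounds on weights rest on this.\<close>

lemma pmf_bind_ge: "pmf p x * pmf (f x) y \<le> pmf (bind_pmf p f) y"
proof -
  have "pmf p x * pmf (f x) y = (\<integral>z. indicator {x} z * pmf (f x) y \<partial>measure_pmf p)"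
    by (simp add: measure_pmf_single)
  also have "\<dots> \<le> (\<integral>z. pmf (f z) y \<partial>measure_pmf p)"
  proof (rule integral_mono)
    show "integrable (measure_pmf p) (\<lambda>z. indicator {x} z * pmf (f x) y)"
      by (rule measure_pmf.integrable_const_bound[where B = 1])
        (auto simp: indicator_def pmf_le_1)
    show "integrable (measure_pmf p) (\<lambda>z. pmf (f z) y)"
      by (rule measure_pmf.integrable_const_bound[where B = 1]) (auto simp: pmf_le_1)
  qed (auto simp: indicator_def)
  finally show ?thesis by (simp add: pmf_bind)
qed

lemma pmf_map_ge: "pmf p x \<le> pmf (map_pmf f p) (f x)"
  using pmf_bind_ge[of p x "\<lambda>z. return_pmf (f z)" "f x"] by (simp add: map_pmf_def)

text \<open>Disjoint sets of mass at least \<delta> number at most 1/\<delta>, so a disjoint family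
  of greatest cardinality exists; a \<open>B x\<close> missing all its members could be added to
  it.\<close>

lemma (in prob_space) maximal_packing:
  fixes B :: "'b \<Rightarrow> 'a set"
  assumes meas: "\<And>x. x \<in> A \<Longrightarrow> B x \<in> events"
    and ge: "\<And>x. x \<in> A \<Longrightarrow> \<delta> \<le> prob (B x)" and pos: "0 < \<delta>"
  shows "\<exists>S\<subseteq>A. finite S \<and> real (card S) * \<delta> \<le> 1 \<and> (\<forall>x\<in>A. \<exists>c\<in>S. B x \<inter> B c \<noteq> {})"
proof -
  define P where "P k \<longleftrightarrow> (\<exists>S\<subseteq>A. finite S \<and> disjoint_family_on B S \<and> card S = k)" for k
  have packing: "real (card S) * \<delta> \<le> 1"
    if S: "S \<subseteq> A" "finite S" "disjoint_family_on B S" for S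
  proof -
    have "real (card S) * \<delta> = (\<Sum>x\<in>S. \<delta>)" by simp
    also have "\<dots> \<le> (\<Sum>x\<in>S. prob (B x))" using S ge by (intro sum_mono) auto
    also have "\<dots> = prob (\<Union>x\<in>S. B x)"
      using S meas by (intro finite_measure_finite_Union[symmetric]) auto
    also have "\<dots> \<le> 1" by (rule prob_le_1)
    finally show ?thesis .
  qed
  have bound: "k \<le> nat \<lfloor>1 / \<delta>\<rfloor>" if "P k" for k
  proof -
    have "real k * \<delta> \<le> 1" using that packing unfolding P_def by auto
    then have "real k \<le> 1 / \<delta>" using pos by (simp add: field_simps)
    then show ?thesis by (simp add: le_nat_floor)
  qed
  have "P 0" unfolding P_def by (intro exI[of _ "{}"]) (auto simp: disjoint_family_on_def)
  then have "P (Greatest P)" and max: "\<And>k. P k \<Longrightarrow> k \<le> Greatest P"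
    using bound GreatestI_nat[of P] Greatest_le_nat[of P] by blast+
  then obtain S where S: "S \<subseteq> A" "finite S" "disjoint_family_on B S" "card S = Greatest P"
    unfolding P_def by auto
  have "\<exists>c\<in>S. B x \<inter> B c \<noteq> {}" if x: "x \<in> A" for x
  proof (rule ccontr)
    assume neg: "\<not> ?thesis"
    \<comment> \<open>Being nonempty, \<open>B x\<close> meets itself, so \<open>x\<close> cannot
      already lie in \<open>S\<close> and the enlarged family really has one more member.\<close>
    have "B x \<noteq> {}" using ge[OF x] pos by auto
    then have "x \<notin> S" using neg by auto
    moreover have "disjoint_family_on B (insert x S)"
      using neg S(3) \<open>x \<notin> S\<close> by (subst disjoint_family_on_insert) auto
    ultimately have "P (Suc (card S))"
      unfolding P_def using x S by (intro exI[of _ "insert x S"]) auto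
    then show False using max S(4) by fastforce
  qed
  then show ?thesis using S packing by blast
qed

text \<open>The points are sorted into dyadic classes according to the size of \<open>prob (B x)\<close>; the class of
  size about \<open>2\<^sup>-\<^sup>n\<close> needs at most \<open>2\<^sup>n\<^sup>+\<^sup>1\<close> centres, and receives total weight \<open>2\<^sup>-\<^sup>n\<^sup>-\<^sup>1\<close>.\<close>

lemma (in prob_space) weighted_centres:
  fixes B :: "'b \<Rightarrow> 'a set"
  assumes meas: "\<And>x. x \<in> U \<Longrightarrow> B x \<in> events"
    and pos: "\<And>x. x \<in> U \<Longrightarrow> 0 < prob (B x)"
  shows "\<exists>(c :: 'b \<Rightarrow> 'b) (q :: 'b pmf). \<forall>x\<in>U.
           c x \<in> U \<and> B x \<inter> B (c x) \<noteq> {} \<and> (prob (B x))\<^sup>2 / 4 \<le> pmf q (c x)"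
proof -
  \<comment> \<open>With \<open>Suc n\<close> in the exponent, class \<open>n\<close> consists of
    the points whose ball has mass in (2^-(n+1), 2^-n]; class 0 thus reaches up to mass 1.\<close>
  define n where "n x = (LEAST n. (1/2) ^ Suc n < prob (B x))" for x
  have n_lower: "(1/2) ^ Suc (n x) < prob (B x)" if x: "x \<in> U" for x
  proof -
    obtain k where "(1/2::real) ^ k < prob (B x)"
      using real_arch_pow_inv[OF pos[OF x], of "1/2"] by auto
    moreover have "(1/2::real) ^ Suc k \<le> (1/2) ^ k" by simp
    ultimately have "(1/2) ^ Suc k < prob (B x)" by linarith
    then show ?thesis unfolding n_def by (rule LeastI)
  qed
  have n_upper: "prob (B x) \<le> (1/2) ^ n x" if x: "x \<in> U" for x
  proof (cases "n x")
    case 0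
    then show ?thesis by simp
  next
    case (Suc k)
    then have "\<not> (1/2) ^ Suc k < prob (B x)" unfolding n_def by (intro not_less_Least) simp
    then show ?thesis using Suc by simp
  qed
  have "\<exists>S\<subseteq>{x \<in> U. n x = k}. finite S \<and> real (card S) * (1/2) ^ Suc k \<le> 1 \<and>
          (\<forall>x\<in>{x \<in> U. n x = k}. \<exists>c\<in>S. B x \<inter> B c \<noteq> {})" for k
    using meas n_lower by (intro maximal_packing) (auto intro: less_imp_le simp del: power_Suc)
  then obtain S where S: "\<And>k. S k \<subseteq> {x \<in> U. n x = k}" "\<And>k. finite (S k)"
      "\<And>k. real (card (S k)) * (1/2) ^ Suc k \<le> 1"
      "\<And>k x. x \<in> U \<Longrightarrow> n x = k \<Longrightarrow> \<exists>c\<in>S k. B x \<inter> B c \<noteq> {}"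
    by (simp del: power_Suc) metis
  \<comment> \<open>The geometric law chooses the class, then a centre is drawn uniformly.
    \<open>pmf_of_set\<close> wants a nonempty set, hence the default \<open>{undefined}\<close> for
    classes without centres; classes of points of \<open>U\<close> always have some.\<close>
  define q where "q = bind_pmf (geometric_pmf (1/2)) (\<lambda>k. pmf_of_set (if S k = {} then {undefined} else S k))"
  have "\<exists>c. \<forall>x\<in>U. c x \<in> S (n x) \<and> B x \<inter> B (c x) \<noteq> {}"
    using S(4) by (intro bchoice) blast
  then obtain c where c: "\<And>x. x \<in> U \<Longrightarrow> c x \<in> S (n x)" "\<And>x. x \<in> U \<Longrightarrow> B x \<inter> B (c x) \<noteq> {}"
    by blast
  have "(prob (B x))\<^sup>2 / 4 \<le> pmf q (c x)" if x: "x \<in> U" for x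
  proof -
    have ne: "S (n x) \<noteq> {}" using c(1)[OF x] by auto
    then have card: "0 < card (S (n x))" using S(2) by (simp add: card_gt_0_iff)
    have "(prob (B x))\<^sup>2 / 4 \<le> ((1/2) ^ n x)\<^sup>2 / 4"
      using n_upper[OF x] by (intro divide_right_mono power_mono) auto
    \<comment> \<open>This splitting explains the square: one factor is the weight of the class, the
      other bounds the uniform weight of a centre from below.\<close>
    also have "\<dots> = (1/2) ^ Suc (n x) * (1/2) ^ Suc (n x)"
      by (simp add: power2_eq_square)
    also have "\<dots> \<le> (1/2) ^ Suc (n x) * (1 / real (card (S (n x))))"
      using S(3)[of "n x"] card by (intro mult_left_mono) (simp_all add: field_simps)
    also have "\<dots> = pmf (geometric_pmf (1/2)) (n x)
        * pmf (pmf_of_set (if S (n x) = {} then {undefined} else S (n x))) (c x)"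
      using ne S(2) c(1)[OF x] by (simp add: indicator_def)
    also have "\<dots> \<le> pmf q (c x)" unfolding q_def by (rule pmf_bind_ge)
    finally show ?thesis .
  qed
  then show ?thesis using c S(1) by blast
qed

section \<open>Common refinements of label partitions, with product weights\<close>

primrec list_prod_pmf :: "(nat \<Rightarrow> 'b pmf) \<Rightarrow> nat \<Rightarrow> 'b list pmf" where
  "list_prod_pmf q 0 = return_pmf []"
| "list_prod_pmf q (Suc n) = bind_pmf (q n) (\<lambda>a. map_pmf ((#) a) (list_prod_pmf q n))"

text \<open>The newest label goes in front, so the list at stage \<open>n\<close> is the tail of the
  one at stage \<open>Suc n\<close>; equality of lists therefore passes to earlier stages, which
  makes the partitions refine one another.\<close>

primrec label_list :: "(nat \<Rightarrow> 'a \<Rightarrow> 'b) \<Rightarrow> nat \<Rightarrow> 'a \<Rightarrow> 'b list" where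
  "label_list l 0 x = []"
| "label_list l (Suc n) x = l n x # label_list l n x"

lemma pmf_list_prod_ge:
  "(\<Prod>j<n. pmf (q j) (l j x)) \<le> pmf (list_prod_pmf q n) (label_list l n x)"
proof (induction n)
  case (Suc n)
  have "(\<Prod>j<Suc n. pmf (q j) (l j x))
      \<le> pmf (q n) (l n x) * pmf (map_pmf ((#) (l n x)) (list_prod_pmf q n)) (l n x # label_list l n x)"
    using mult_left_mono[OF order_trans[OF Suc pmf_map_ge], of "pmf (q n) (l n x)" "(#) (l n x)"]
    by (simp add: mult.commute)
  also have "\<dots> \<le> pmf (list_prod_pmf q (Suc n)) (label_list l (Suc n) x)"
    using pmf_bind_ge[of "q n" "l n x"] by simp
  finally show ?case .
qed simp

text \<open>Summation by parts: multiplying by \<open>1 - z\<close> collapses the geometric weights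
  that each \<open>s j\<close> collects, leaving a boundary term.\<close>

lemma sum_power_partial_sums:
  fixes s :: "nat \<Rightarrow> real"
  shows "(1 - z) * (\<Sum>i<n. z ^ i * (\<Sum>j<Suc i. s j)) + z ^ n * (\<Sum>j<n. s j) = (\<Sum>j<n. z ^ j * s j)"
proof (induction n)
  case (Suc n)
  then show ?case by (simp only: sum.lessThan_Suc power_Suc) (simp add: ring_distribs)
qed simp

lemma sum_power_le:
  fixes z :: real
  assumes "0 \<le> z" "z \<le> 1/4"
  shows "(\<Sum>i<n. z ^ i) \<le> 4/3"
proof -
  have "(\<Sum>i<n. z ^ i) = (1 - z ^ n) / (1 - z)" using assms by (simp add: sum_gp_strict)
  also have "\<dots> \<le> 1 / (3/4)" using assms by (intro frac_le) auto
  finally show ?thesis by simp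
qed

lemma sqrt_sum_le:
  assumes "\<And>i. i \<in> A \<Longrightarrow> 0 \<le> f i"
  shows "sqrt (\<Sum>i\<in>A. f i) \<le> (\<Sum>i\<in>A. sqrt (f i))"
  using assms
proof (induction A rule: infinite_finite_induct)
  case (insert a A)
  have "sqrt (f a + sum f A) \<le> sqrt (f a) + sqrt (sum f A)"
    using insert by (intro sqrt_add_le_add_sqrt sum_nonneg) auto
  then show ?case using insert by auto
qed auto

text \<open>The logarithm turns the product into a sum and the square root is subadditive; each
  factor 1/2 costs sqrt (ln 2), which is below 1.\<close>

lemma sqrt_ln_inv_le_sum:
  fixes s :: "nat \<Rightarrow> real"
  assumes s: "\<And>j. j < n \<Longrightarrow> 0 < s j \<and> s j \<le> 1"
    and m: "(\<Prod>j<n. s j / 2) \<le> m"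
  shows "sqrt (ln (1 / m)) \<le> (\<Sum>j<n. 1 + sqrt (ln (1 / s j)))"
proof -
  have prod_pos: "0 < (\<Prod>j<n. s j / 2)" using s by (intro prod_pos) auto
  moreover from this m have "0 < m" by (rule less_le_trans)
  ultimately have "ln (1 / m) \<le> ln (1 / (\<Prod>j<n. s j / 2))"
    using m by (intro ln_mono frac_le) auto
  also have "\<dots> = - (\<Sum>j<n. ln (s j / 2))"
  proof -
    have "s j / 2 \<noteq> 0" if "j \<in> {..<n}" for j using s[of j] that by auto
    then have "ln (\<Prod>j<n. s j / 2) = (\<Sum>j<n. ln (s j / 2))" by (intro ln_prod finite_lessThan)
    moreover have "ln (1 / x) = - ln x" if "0 < x" for x :: real using that by (simp add: ln_div)
    ultimately show ?thesis using prod_pos by metis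
  qed
  also have "\<dots> = (\<Sum>j<n. ln 2 + ln (1 / s j))"
    unfolding sum_negf[symmetric]
  proof (intro sum.cong refl)
    fix j assume "j \<in> {..<n}"
    then show "- ln (s j / 2) = ln 2 + ln (1 / s j)" using s[of j] by (simp add: ln_div)
  qed
  finally have "sqrt (ln (1 / m)) \<le> sqrt (\<Sum>j<n. ln 2 + ln (1 / s j))" by simp
  also have "\<dots> \<le> (\<Sum>j<n. sqrt (ln 2 + ln (1 / s j)))"
    using s by (intro sqrt_sum_le) (auto intro!: add_nonneg_nonneg)
  also have "\<dots> \<le> (\<Sum>j<n. 1 + sqrt (ln (1 / s j)))"
  proof (intro sum_mono)
    fix j assume "j \<in> {..<n}"
    then have "sqrt (ln 2 + ln (1 / s j)) \<le> sqrt (ln 2) + sqrt (ln (1 / s j))"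
      using s by (intro sqrt_add_le_add_sqrt) auto
    moreover have "sqrt (ln 2) \<le> 1" using ln_2_less_1 by simp
    ultimately show "sqrt (ln 2 + ln (1 / s j)) \<le> 1 + sqrt (ln (1 / s j))" by linarith
  qed
  finally show ?thesis .
qed

text \<open>The partitions are the successive common refinements of the label partitions. Each cell of
  the \<open>i\<close>-th one carries a point charged with \<open>2\<^sup>-\<^sup>i\<^sup>-\<^sup>1\<close> times the product of its label weights.\<close>

lemma partitions_of_labels:
  fixes l :: "nat \<Rightarrow> 'a \<Rightarrow> 'b" and q :: "nat \<Rightarrow> 'b pmf"
  assumes T: "T \<noteq> {}" and z: "0 \<le> z" "z \<le> 1/4"
    and pos: "\<And>i x. x \<in> T \<Longrightarrow> 0 < pmf (q i) (l i x)"
    and bound: "\<And>n x. x \<in> T \<Longrightarrow> (\<Sum>i<n. z ^ i * sqrt (ln (1 / pmf (q i) (l i x)))) \<le> K"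
  shows "\<exists>\<C> (\<mu> :: 'a pmf). increasing_partitions T \<C> \<and> set_pmf \<mu> \<subseteq> T \<and>
     (\<forall>i. \<forall>C\<in>\<C> i. \<forall>x\<in>C. \<forall>y\<in>C. l i x = l i y) \<and>
     (\<forall>i. \<forall>x\<in>T. 0 < measure_pmf.prob \<mu> (cell (\<C> i) x)) \<and>
     (\<forall>n. \<forall>x\<in>T. (\<Sum>i<n. z ^ i * sqrt (ln (1 / measure_pmf.prob \<mu> (cell (\<C> i) x))))
        \<le> 4/3 * (4/3 + K))"
proof -
  \<comment> \<open>Stage \<open>i\<close> uses the \<open>i + 1\<close> labels of index 0 to
    \<open>i\<close>, so that a cell of \<open>\<C> i\<close> determines label \<open>i\<close>
    itself.\<close>
  define L where "L i = label_list l (Suc i)" for i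
  define Cl where "Cl i x = {y \<in> T. L i y = L i x}" for i x
  define \<C> where "\<C> i = Cl i ` T" for i
  \<comment> \<open>A representative of the cell with label list \<open>as\<close>. The second
    disjunct sends lists realised by no point to an arbitrary point of \<open>T\<close>, so no mass
    leaves \<open>T\<close>.\<close>
  define pick where "pick i as = (SOME x. x \<in> T \<and> (L i x = as \<or> as \<notin> L i ` T))" for i as
  define \<mu> where "\<mu> = bind_pmf (geometric_pmf (1/2)) (\<lambda>i. map_pmf (pick i) (list_prod_pmf q (Suc i)))"
  have "\<exists>x. x \<in> T \<and> (L i x = as \<or> as \<notin> L i ` T)" for i as
    using T by blast
  then have "pick i as \<in> T \<and> (L i (pick i as) = as \<or> as \<notin> L i ` T)" for i as
    unfolding pick_def by (rule someI_ex)
  then have pick: "pick i as \<in> T" "as \<in> L i ` T \<Longrightarrow> L i (pick i as) = as" for i as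
    by blast+
  have pick_cell: "pick i (L i x) \<in> Cl i x" if "x \<in> T" for i x
    using pick that by (auto simp: Cl_def)
  have self: "x \<in> Cl i x" if "x \<in> T" for i x using that by (simp add: Cl_def)
  have cell: "cell (\<C> i) x = Cl i x" if x: "x \<in> T" for i x
    unfolding cell_def
  proof (rule the_equality)
    show "Cl i x \<in> \<C> i \<and> x \<in> Cl i x" using x by (simp add: \<C>_def self)
    fix C assume "C \<in> \<C> i \<and> x \<in> C"
    then show "C = Cl i x" by (auto simp: \<C>_def Cl_def)
  qed
  have part: "partition_on T (\<C> i)" for i
    by (rule partition_onI) (auto simp: \<C>_def Cl_def disjnt_def)
  moreover have "refines T (\<C> (Suc i)) (\<C> i)" for i
    unfolding refines_def
  proof (intro conjI part ballI)
    fix X assume "X \<in> \<C> (Suc i)"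
    then obtain x where "x \<in> T" "X = Cl (Suc i) x" by (auto simp: \<C>_def)
    then show "\<exists>Y\<in>\<C> i. X \<subseteq> Y"
      by (intro bexI[of _ "Cl i x"]) (auto simp: \<C>_def Cl_def L_def)
  qed
  ultimately have inc: "increasing_partitions T \<C>" by (simp add: increasing_partitions_def)
  have set: "set_pmf \<mu> \<subseteq> T" using pick(1) by (auto simp: \<mu>_def simp del: list_prod_pmf.simps)
  have lab: "\<forall>x\<in>C. \<forall>y\<in>C. l i x = l i y" if "C \<in> \<C> i" for i C
    using that by (auto simp: \<C>_def Cl_def L_def)
  \<comment> \<open>The geometric weight 2^-(i+1) of level \<open>i\<close> is spread over the
    \<open>i + 1\<close> factors as one half each.\<close>
  have mass: "(\<Prod>j<Suc i. pmf (q j) (l j x) / 2) \<le> measure_pmf.prob \<mu> (cell (\<C> i) x)"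
    if x: "x \<in> T" for i x
  proof -
    have "(\<Prod>j<Suc i. pmf (q j) (l j x) / 2) = (1/2) ^ Suc i * (\<Prod>j<Suc i. pmf (q j) (l j x))"
      by (simp only: prod_dividef) (simp add: power_one_over field_simps)
    also have "\<dots> \<le> (1/2) ^ Suc i * pmf (map_pmf (pick i) (list_prod_pmf q (Suc i))) (pick i (L i x))"
      unfolding L_def
      by (intro mult_left_mono order_trans[OF pmf_list_prod_ge pmf_map_ge]) simp
    also have "\<dots> = pmf (geometric_pmf (1/2)) i
        * pmf (map_pmf (pick i) (list_prod_pmf q (Suc i))) (pick i (L i x))"
      by (simp del: list_prod_pmf.simps)
    also have "\<dots> \<le> pmf \<mu> (pick i (L i x))" unfolding \<mu>_def by (rule pmf_bind_ge)
    also have "\<dots> \<le> measure_pmf.prob \<mu> (Cl i x)"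
      using pick_cell[OF x] unfolding measure_pmf_single[symmetric]
      by (intro measure_pmf.finite_measure_mono) auto
    finally show ?thesis by (simp only: cell[OF x])
  qed
  have mass_pos: "0 < measure_pmf.prob \<mu> (cell (\<C> i) x)" if x: "x \<in> T" for i x
    using pos[OF x] by (intro less_le_trans[OF _ mass[OF x]] prod_pos) auto
  have "(\<Sum>i<n. z ^ i * sqrt (ln (1 / measure_pmf.prob \<mu> (cell (\<C> i) x)))) \<le> 4/3 * (4/3 + K)"
    if x: "x \<in> T" for n x
  proof -
    define s where "s j = 1 + sqrt (ln (1 / pmf (q j) (l j x)))" for j
    have "0 \<le> ln (1 / pmf (q j) (l j x))" for j
      using pos[OF x, of j] pmf_le_1[of "q j" "l j x"] by simp
    then have s: "0 \<le> s j" for j by (simp add: s_def add_nonneg_nonneg)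
    \<comment> \<open>This double sum is handled by summation by parts: dropping the nonnegative
      boundary term bounds \<open>(1 - z) * A\<close>, and \<open>1 - z\<close> is at least 3/4,
      whence the factor 4/3.\<close>
    define A where "A = (\<Sum>i<n. z ^ i * (\<Sum>j<Suc i. s j))"
    have A: "0 \<le> A" using z s unfolding A_def by (intro sum_nonneg mult_nonneg_nonneg) auto
    have "(\<Sum>i<n. z ^ i * sqrt (ln (1 / measure_pmf.prob \<mu> (cell (\<C> i) x)))) \<le> A"
      unfolding A_def s_def using pos[OF x] pmf_le_1 z
      by (intro sum_mono mult_left_mono sqrt_ln_inv_le_sum mass[OF x]) auto
    also have "3/4 * A \<le> (1 - z) * A" using A z by (intro mult_right_mono) auto
    then have "A \<le> 4/3 * ((1 - z) * A)" by simp
    also have "0 \<le> z ^ n * (\<Sum>j<n. s j)" using s z by (intro mult_nonneg_nonneg sum_nonneg) auto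
    then have "(1 - z) * A \<le> (\<Sum>j<n. z ^ j * s j)"
      using sum_power_partial_sums[of z s n] unfolding A_def by linarith
    also have "(\<Sum>j<n. z ^ j * s j) \<le> 4/3 + K"
      using bound[OF x] sum_power_le[OF z] unfolding s_def
      by (simp add: distrib_left sum.distrib add_mono)
    finally show ?thesis by simp
  qed
  then show ?thesis using inc set lab mass_pos by blast
qed

section \<open>Truncated distances and the weak Lp ball\<close>

text \<open>Halving \<open>s\<close> changes the left-hand side by at most \<open>4 s\<^sup>2\<^sup>-\<^sup>p\<close>; these changes form a geometric series.\<close>

lemma sum_min_square_weak_Lp:
  fixes v :: "nat \<Rightarrow> real"
  assumes I: "finite I" and p: "1 \<le> p" "p < 2" and s: "0 < s"
    and weak: "\<And>t. 0 < t \<Longrightarrow> t powr p * real (card {k \<in> I. t \<le> \<bar>v k\<bar>}) \<le> 1"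
  shows "(\<Sum>k\<in>I. min ((v k)\<^sup>2) (s\<^sup>2)) \<le> 4 / (1 - 2 powr (p - 2)) * s powr (2 - p)"
proof -
  \<comment> \<open>The fixed point of the halving recursion, that is, the solution of A = 4 + A
    2^(p-2).\<close>
  define A where "A = 4 / (1 - 2 powr (p - 2))"
  have two: "2 powr (p - 2) < 1" using p by (simp add: powr_less_one)
  have "1 - 2 powr (p - 2) \<noteq> 0" using two by linarith
  then have "A * (1 - 2 powr (p - 2)) = 4"
    unfolding A_def by (metis nonzero_eq_divide_eq)
  then have A: "4 + A * 2 powr (p - 2) = A" by (simp add: algebra_simps)
  have A0: "0 \<le> A" using two by (simp add: A_def)
  \<comment> \<open>Lowering the truncation from \<open>t\<close> to \<open>t/2\<close> changes only
    the terms with \<bar>v k\<bar> \<ge> t/2. There are at most (t/2)^(-p) of them, each losing at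
    most t^2, and 2^p \<le> 4.\<close>
  have step: "(\<Sum>k\<in>I. min ((v k)\<^sup>2) (t\<^sup>2)) \<le> 4 * t powr (2 - p) + (\<Sum>k\<in>I. min ((v k)\<^sup>2) ((t/2)\<^sup>2))"
    if t: "0 < t" for t
  proof -
    have "(\<Sum>k\<in>I. min ((v k)\<^sup>2) (t\<^sup>2))
        \<le> (\<Sum>k\<in>I. t\<^sup>2 * (if t/2 \<le> \<bar>v k\<bar> then 1 else 0) + min ((v k)\<^sup>2) ((t/2)\<^sup>2))"
    proof (intro sum_mono)
      fix k
      show "min ((v k)\<^sup>2) (t\<^sup>2) \<le> t\<^sup>2 * (if t/2 \<le> \<bar>v k\<bar> then 1 else 0) + min ((v k)\<^sup>2) ((t/2)\<^sup>2)"
      proof (cases "t/2 \<le> \<bar>v k\<bar>")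
        case False
        then have "\<bar>v k\<bar>\<^sup>2 \<le> (t/2)\<^sup>2" by (intro power_mono) auto
        then show ?thesis using False by auto
      qed (simp add: min.coboundedI2 add_increasing2)
    qed
    also have "\<dots> = t\<^sup>2 * real (card {k \<in> I. t/2 \<le> \<bar>v k\<bar>}) + (\<Sum>k\<in>I. min ((v k)\<^sup>2) ((t/2)\<^sup>2))"
      using I by (simp add: sum.distrib sum_distrib_left[symmetric] sum.If_cases Int_def)
    also have "t\<^sup>2 * real (card {k \<in> I. t/2 \<le> \<bar>v k\<bar>})
        = (t\<^sup>2 / (t/2) powr p) * ((t/2) powr p * real (card {k \<in> I. t/2 \<le> \<bar>v k\<bar>}))"
      using t by simp
    also have "\<dots> \<le> t\<^sup>2 / (t/2) powr p * 1"
      using weak[of "t/2"] t by (intro mult_left_mono) auto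
    also have "\<dots> = 2 powr p * t powr (2 - p)"
      using t by (simp add: powr_diff powr_divide powr_numeral)
    also have "2 powr p \<le> (2::real) powr 2" using p by (intro powr_mono) auto
    then have "2 powr p * t powr (2 - p) \<le> 4 * t powr (2 - p)"
      by (intro mult_right_mono) (auto simp: powr_numeral)
    finally show ?thesis by simp
  qed
  \<comment> \<open>After \<open>n\<close> halvings the rest is bounded trivially by
    \<open>card I\<close> times the squared truncation level; this error vanishes as
    \<open>n\<close> grows.\<close>
  have approx: "(\<Sum>k\<in>I. min ((v k)\<^sup>2) (t\<^sup>2)) \<le> A * t powr (2 - p) + real (card I) * t\<^sup>2 * (1/4) ^ n"
    if "0 < t" for t n
    using that
  proof (induction n arbitrary: t)
    case 0
    have "(\<Sum>k\<in>I. min ((v k)\<^sup>2) (t\<^sup>2)) \<le> (\<Sum>k\<in>I. t\<^sup>2)" by (intro sum_mono) auto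
    moreover have "0 \<le> A * t powr (2 - p)" using A0 by simp
    ultimately show ?case by simp
  next
    case (Suc n)
    have "(\<Sum>k\<in>I. min ((v k)\<^sup>2) (t\<^sup>2))
        \<le> 4 * t powr (2 - p) + (A * (t/2) powr (2 - p) + real (card I) * (t/2)\<^sup>2 * (1/4) ^ n)"
      using step[OF Suc.prems] Suc.IH[of "t/2"] Suc.prems by simp
    also have "(t/2) powr (2 - p) = t powr (2 - p) * 2 powr (p - 2)"
      using Suc.prems by (simp add: powr_divide powr_diff)
    also have "4 * t powr (2 - p) + (A * (t powr (2 - p) * 2 powr (p - 2))
          + real (card I) * (t/2)\<^sup>2 * (1/4) ^ n)
        = (4 + A * 2 powr (p - 2)) * t powr (2 - p) + real (card I) * t\<^sup>2 * (1/4) ^ Suc n"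
      by (simp add: algebra_simps power2_eq_square)
    finally show ?case by (simp only: A)
  qed
  have "(\<lambda>n. A * s powr (2 - p) + real (card I) * s\<^sup>2 * (1/4) ^ n)
      \<longlonglongrightarrow> A * s powr (2 - p) + real (card I) * s\<^sup>2 * 0"
    by (intro tendsto_intros LIMSEQ_realpow_zero) auto
  then have "(\<lambda>n. A * s powr (2 - p) + real (card I) * s\<^sup>2 * (1/4) ^ n) \<longlonglongrightarrow> A * s powr (2 - p)"
    by simp
  then show ?thesis
    unfolding A_def[symmetric] by (rule LIMSEQ_le_const) (use approx[OF s] in blast)
qed

lemma weak_Lp_ballD:
  assumes "v \<in> weak_Lp_ball N p" "0 < t"
  shows "t powr p * real (card {k \<in> {1..N}. t \<le> \<bar>v k\<bar>}) \<le> 1"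
proof -
  have "ennreal (t powr p) * emeasure (counting N) {k\<in>{1..N}. t \<le> \<bar>v k\<bar>}
      \<le> (SUP t\<in>{0..}. ennreal (t powr p) * emeasure (counting N) {k\<in>{1..N}. t \<le> \<bar>v k\<bar>})"
    using assms by (intro SUP_upper) auto
  also have "\<dots> \<le> 1" using assms by (simp add: weak_Lp_ball_def)
  also have "emeasure (counting N) {k\<in>{1..N}. t \<le> \<bar>v k\<bar>} = ennreal (real (card {k\<in>{1..N}. t \<le> \<bar>v k\<bar>}))"
    by (subst emeasure_count_space_finite) (auto simp: ennreal_of_nat_eq_real_of_nat)
  finally have "ennreal (t powr p * real (card {k \<in> {1..N}. t \<le> \<bar>v k\<bar>})) \<le> ennreal 1"
    by (simp add: ennreal_mult)
  then show ?thesis by (subst (asm) ennreal_le_iff) auto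
qed

text \<open>Truncation at a level \<open>s\<close> \<ge> 0 is subadditive on nonnegative reals, so
  Minkowski's inequality survives it.\<close>

lemma L2_set_min_triangle:
  assumes "0 \<le> s"
  shows "L2_set (\<lambda>k. min (\<bar>a k + b k\<bar>) s) A \<le> L2_set (\<lambda>k. min (\<bar>a k\<bar>) s) A + L2_set (\<lambda>k. min (\<bar>b k\<bar>) s) A"
proof -
  have "L2_set (\<lambda>k. min (\<bar>a k + b k\<bar>) s) A \<le> L2_set (\<lambda>k. min (\<bar>a k\<bar>) s + min (\<bar>b k\<bar>) s) A"
    using assms by (intro L2_set_mono) auto
  also have "\<dots> \<le> L2_set (\<lambda>k. min (\<bar>a k\<bar>) s) A + L2_set (\<lambda>k. min (\<bar>b k\<bar>) s) A"
    by (rule L2_set_triangle_ineq)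
  finally show ?thesis .
qed

lemma min_abs_squared: "0 \<le> s \<Longrightarrow> (min (\<bar>a\<bar>) s)\<^sup>2 = min (a\<^sup>2) (s\<^sup>2)" for a s :: real
  using abs_le_square_iff[of a s] by (auto simp: min_def)

lemma trunc_dist_eq_L2_set:
  assumes "0 < r"
  shows "trunc_dist N r \<gamma> i f g = L2_set (\<lambda>k. min (\<bar>f k - g k\<bar>) (r powr (- 2 * \<gamma> * real i))) {1..N}"
proof -
  have "(r powr (- 2 * \<gamma> * real i))\<^sup>2 = r powr (- 4 * \<gamma> * real i)"
    using assms by (simp add: power2_eq_square powr_add[symmetric] mult.assoc)
  then show ?thesis
    unfolding trunc_dist_def L2_set_def
    by (subst lebesgue_integral_count_space_finite) (simp_all add: min_abs_squared)
qed

text \<open>This is where \<gamma> = 1/(2-p) enters: at truncation level s = r^(-2 \<gamma> i) the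
  bound s^(2-p) becomes exactly r^(-2i).\<close>

lemma L2_set_min_weak_Lp:
  assumes v: "v \<in> weak_Lp_ball N p" and p: "1 \<le> p" "p < 2" and r: "0 < r" and \<gamma>: "\<gamma> = 1 / (2 - p)"
  shows "L2_set (\<lambda>k. min (\<bar>v k\<bar>) (r powr (- 2 * \<gamma> * real i))) {1..N}
           \<le> sqrt (4 / (1 - 2 powr (p - 2))) * r powr (- real i)"
proof -
  define s where "s = r powr (- 2 * \<gamma> * real i)"
  have s: "0 < s" using r by (simp add: s_def)
  have "L2_set (\<lambda>k. min (\<bar>v k\<bar>) s) {1..N} = sqrt (\<Sum>k\<in>{1..N}. min ((v k)\<^sup>2) (s\<^sup>2))"
    using s by (simp add: L2_set_def min_abs_squared)
  also have "\<dots> \<le> sqrt (4 / (1 - 2 powr (p - 2)) * s powr (2 - p))"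
    using sum_min_square_weak_Lp[OF _ p s weak_Lp_ballD[OF v]] by simp
  also have "s powr (2 - p) = (r powr (- real i))\<^sup>2"
    using p r by (simp add: s_def powr_powr \<gamma> power2_eq_square powr_add[symmetric])
  also have "sqrt (4 / (1 - 2 powr (p - 2)) * (r powr (- real i))\<^sup>2)
      = sqrt (4 / (1 - 2 powr (p - 2))) * r powr (- real i)"
    by (subst real_sqrt_mult) simp
  finally show ?thesis unfolding s_def .
qed

text \<open>Truncation is simply discarded on the \<open>U\<close> components, where the Euclidean
  distance is controlled, and retained on the two weak components, each paying once.\<close>

lemma trunc_dist_decomposition:
  assumes fg: "\<And>k. k \<in> {1..N} \<Longrightarrow> f k = u k + v k" "\<And>k. k \<in> {1..N} \<Longrightarrow> g k = u' k + v' k"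
    and v: "v \<in> weak_Lp_ball N p" "v' \<in> weak_Lp_ball N p"
    and p: "1 \<le> p" "p < 2" and r: "0 < r" and \<gamma>: "\<gamma> = 1 / (2 - p)"
  shows "trunc_dist N r \<gamma> i f g \<le> L2_set (\<lambda>k. u k - u' k) {1..N}
           + 2 * sqrt (4 / (1 - 2 powr (p - 2))) * r powr (- real i)"
proof -
  define s where "s = r powr (- 2 * \<gamma> * real i)"
  have s: "0 \<le> s" by (simp add: s_def)
  have "trunc_dist N r \<gamma> i f g = L2_set (\<lambda>k. min (\<bar>(u k - u' k) + (v k + - v' k)\<bar>) s) {1..N}"
    unfolding trunc_dist_eq_L2_set[OF r] s_def using fg
    by (intro L2_set_cong refl arg_cong2[where f = min] arg_cong[where f = abs]) auto
  also have "\<dots> \<le> L2_set (\<lambda>k. min (\<bar>u k - u' k\<bar>) s) {1..N} + L2_set (\<lambda>k. min (\<bar>v k + - v' k\<bar>) s) {1..N}"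
    by (rule L2_set_min_triangle[OF s])
  also have "L2_set (\<lambda>k. min (\<bar>u k - u' k\<bar>) s) {1..N} \<le> L2_set (\<lambda>k. \<bar>u k - u' k\<bar>) {1..N}"
    using s by (intro L2_set_mono) auto
  also have "\<dots> = L2_set (\<lambda>k. u k - u' k) {1..N}" by (simp add: L2_set_def)
  also have "L2_set (\<lambda>k. min (\<bar>v k + - v' k\<bar>) s) {1..N}
      \<le> L2_set (\<lambda>k. min (\<bar>v k\<bar>) s) {1..N} + L2_set (\<lambda>k. min (\<bar>- v' k\<bar>) s) {1..N}"
    by (rule L2_set_min_triangle[OF s])
  finally show ?thesis
    using L2_set_min_weak_Lp[OF v(1) p r \<gamma>, of i] L2_set_min_weak_Lp[OF v(2) p r \<gamma>, of i]
    unfolding s_def by simp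
qed

section \<open>Balls in \<open>U\<close> and the entropy integral\<close>

definition Lball :: "nat \<Rightarrow> (nat \<Rightarrow> real) set \<Rightarrow> (nat \<Rightarrow> real) \<Rightarrow> real \<Rightarrow> (nat \<Rightarrow> real) set" where
  "Lball N U x e = {y \<in> U. L2_set (\<lambda>k. x k - y k) {1..N} \<le> e}"

text \<open>\<open>U\<close> may fail to be Borel, so the ball is exhibited as the trace on
  \<open>U\<close> of a Borel set.\<close>

lemma Lball_measurable:
  assumes M: "prob_measure_on N U M" and U: "U \<subseteq> RN N"
  shows "Lball N U x e \<in> sets M"
proof -
  have "(\<lambda>y. L2_set (\<lambda>k. x k - y k) {1..N}) \<in> borel_measurable (PiM {1..N} (\<lambda>_. borel))"
    unfolding L2_set_def by measurable
  then have "{y \<in> space (PiM {1..N} (\<lambda>_. borel)). L2_set (\<lambda>k. x k - y k) {1..N} \<le> e}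
      \<in> sets (PiM {1..N} (\<lambda>_. borel))"
    by measurable
  moreover have "Lball N U x e
      = U \<inter> {y \<in> space (PiM {1..N} (\<lambda>_. borel)). L2_set (\<lambda>k. x k - y k) {1..N} \<le> e}"
    using U by (auto simp: Lball_def space_PiM)
  ultimately have "Lball N U x e \<in> sets (restrict_space (PiM {1..N} (\<lambda>_. borel)) U)"
    by (auto simp: sets_restrict_space)
  then show ?thesis using M by (auto simp: prob_measure_on_def)
qed

lemma sqrt_log_inv_antimono:
  assumes "0 \<le> a" "a \<le> b"
  shows "sqrt_log_inv b \<le> sqrt_log_inv a"
  using assms by (auto simp: sqrt_log_inv_def ln_div intro!: ennreal_leI)

text \<open>A ball of radius \<open>e\<close> with mass zero would make the integrand infinite on
  [0, e]. The sum is compared with a lower Riemann sum: the integrand is nonincreasing, and the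
  interval (z^(i+1), z^i] has length (1-z) z^i \<ge> (3/4) z^i.\<close>

lemma entropy_integral_bounds:
  assumes M: "prob_measure_on N U M" and U: "U \<subseteq> RN N"
    and int: "(\<integral>\<^sup>+e\<in>{0..}. sqrt_log_inv (measure M (Lball N U x e)) \<partial>lborel) \<le> ennreal D"
    and D: "0 \<le> D" and z: "0 < z" "z \<le> 1/4"
  shows "0 < e \<Longrightarrow> 0 < measure M (Lball N U x e)"
    and "(\<Sum>i<n. z ^ i * sqrt (ln (1 / measure M (Lball N U x (z ^ i))))) \<le> 4/3 * D"
proof -
  interpret prob_space M using M by (simp add: prob_measure_on_def)
  have mono: "measure M (Lball N U x e) \<le> measure M (Lball N U x e')" if "e \<le> e'" for e e'
    using that Lball_measurable[OF M U] by (intro finite_measure_mono) (auto simp: Lball_def)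
  have anti: "sqrt_log_inv (measure M (Lball N U x e')) \<le> sqrt_log_inv (measure M (Lball N U x e))"
    if "e \<le> e'" for e e'
    using mono[OF that] by (intro sqrt_log_inv_antimono) auto
  show pos: "0 < measure M (Lball N U x e)" if e: "0 < e" for e
  proof (rule ccontr)
    assume "\<not> ?thesis"
    then have 0: "measure M (Lball N U x e) = 0" using measure_nonneg[of M] by (simp add: not_less antisym)
    have "\<infinity> = (\<integral>\<^sup>+t. \<infinity> * indicator {0..e} t \<partial>lborel)"
      using e by (subst nn_integral_cmult_indicator) (auto simp: ennreal_top_mult)
    also have "\<dots> \<le> (\<integral>\<^sup>+t\<in>{0..}. sqrt_log_inv (measure M (Lball N U x t)) \<partial>lborel)"
    proof (intro nn_integral_mono)
      fix t :: real
      show "\<infinity> * indicator {0..e} t \<le> sqrt_log_inv (measure M (Lball N U x t)) * indicator {0..} t"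
        using anti[of t e] 0 by (auto simp: indicator_def sqrt_log_inv_def)
    qed
    also have "\<dots> \<le> ennreal D" by (rule int)
    finally show False by (simp add: top_unique)
  qed
  define c where "c i = sqrt (ln (1 / measure M (Lball N U x (z ^ i))))" for i
  have c: "0 \<le> c i" "sqrt_log_inv (measure M (Lball N U x (z ^ i))) = ennreal (c i)" for i
    using pos[of "z ^ i"] z by (auto simp: c_def sqrt_log_inv_def)
  \<comment> \<open>The half-open intervals are disjoint, so at most one term is nonzero at a given
    \<open>t\<close>, and there monotonicity applies.\<close>
  have "(\<Sum>i<n. ennreal (c i) * indicator {z ^ Suc i<..z ^ i} t)
      \<le> sqrt_log_inv (measure M (Lball N U x t)) * indicator {0..} t" for t
  proof (cases "\<exists>i<n. t \<in> {z ^ Suc i<..z ^ i}")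
    case True
    then obtain i where i: "i < n" "t \<in> {z ^ Suc i<..z ^ i}" by blast
    have "t \<notin> {z ^ Suc j<..z ^ j}" if "j \<noteq> i" for j
    proof (cases "j < i")
      case True
      then have "z ^ i \<le> z ^ Suc j" using z by (intro power_decreasing) auto
      then show ?thesis using i by (auto simp del: power_Suc)
    next
      case False
      then have "z ^ j \<le> z ^ Suc i" using z that by (intro power_decreasing) auto
      then show ?thesis using i by (auto simp del: power_Suc)
    qed
    then have "(\<Sum>i<n. ennreal (c i) * indicator {z ^ Suc i<..z ^ i} t) = ennreal (c i)"
      using i by (subst sum.remove[of _ i]) (auto intro!: sum.neutral simp del: power_Suc)
    moreover have "0 < z ^ Suc i" using z by simp
    then have "0 \<le> t" using i by (auto simp del: power_Suc)
    ultimately show ?thesis using anti[of t "z ^ i"] i c by simp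
  next
    case False
    then have "(\<Sum>i<n. ennreal (c i) * indicator {z ^ Suc i<..z ^ i} t) = 0"
      by (intro sum.neutral) (auto simp del: power_Suc)
    then show ?thesis by simp
  qed
  then have "(\<integral>\<^sup>+t. (\<Sum>i<n. ennreal (c i) * indicator {z ^ Suc i<..z ^ i} t) \<partial>lborel) \<le> ennreal D"
    by (intro order_trans[OF nn_integral_mono int])
  also have "(\<integral>\<^sup>+t. (\<Sum>i<n. ennreal (c i) * indicator {z ^ Suc i<..z ^ i} t) \<partial>lborel)
      = (\<Sum>i<n. ennreal (c i) * ennreal (z ^ i - z ^ Suc i))"
    using z by (subst nn_integral_sum)
      (auto simp: nn_integral_cmult_indicator mult_left_le_one_le intro!: sum.cong)
  also have "\<dots> = ennreal (\<Sum>i<n. c i * (z ^ i - z ^ Suc i))"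
    using c z by (subst sum_ennreal[symmetric])
      (auto simp: ennreal_mult mult_left_le_one_le intro!: sum.cong)
  finally have le: "(\<Sum>i<n. c i * (z ^ i - z ^ Suc i)) \<le> D" using D by simp
  have "3/4 * (\<Sum>i<n. z ^ i * c i) = (\<Sum>i<n. 3/4 * (z ^ i * c i))" by (rule sum_distrib_left)
  also have "\<dots> \<le> (\<Sum>i<n. (1 - z) * (z ^ i * c i))"
    using z c by (intro sum_mono mult_right_mono) auto
  also have "\<dots> = (\<Sum>i<n. c i * (z ^ i - z ^ Suc i))" by (simp add: algebra_simps)
  also note le
  finally show "(\<Sum>i<n. z ^ i * sqrt (ln (1 / measure M (Lball N U x (z ^ i))))) \<le> 4/3 * D"
    unfolding c_def by simp
qed

text \<open>Squaring the ball mass merely doubles its logarithm, so the loss in the choice of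
  centres costs constants only.\<close>

lemma sqrt_ln_inv_square_le:
  assumes m: "0 < m" "m \<le> 1" and q: "m\<^sup>2 / 4 \<le> q"
  shows "sqrt (ln (1 / q)) \<le> 2 + 2 * sqrt (ln (1 / m))"
proof -
  have m4: "0 < m\<^sup>2 / 4" using m by simp
  then have "0 < q" using q by linarith
  have "ln (m\<^sup>2 / 4) \<le> ln q" using m4 q by (intro ln_mono)
  then have "ln (1 / q) \<le> ln 4 + 2 * ln (1 / m)"
    using m \<open>0 < q\<close> by (simp add: ln_div ln_realpow)
  also have "ln (4::real) \<le> 4" using ln_le_minus_one[of "4::real"] by simp
  moreover have "0 \<le> ln (1 / m)" using m by simp
  ultimately have "ln (1 / q) \<le> 4 + 4 * ln (1 / m)" by linarith
  then have "sqrt (ln (1 / q)) \<le> sqrt (4 + 4 * ln (1 / m))" by simp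
  also have "\<dots> \<le> sqrt 4 + sqrt (4 * ln (1 / m))"
    using m by (intro sqrt_add_le_add_sqrt) auto
  finally show ?thesis by (simp add: real_sqrt_mult)
qed

lemma suminf_sqrt_log_inv_le:
  assumes r: "0 < r" and m: "\<And>i. 0 < m i \<and> m i \<le> 1"
    and bound: "\<And>n. (\<Sum>i<n. (1 / r) ^ i * sqrt (ln (1 / m i))) \<le> K"
  shows "(\<Sum>i. ennreal (r powr (- real i)) * sqrt_log_inv (m i)) \<le> ennreal K"
proof (rule suminf_le_const)
  fix n
  have "(\<Sum>i<n. ennreal (r powr (- real i)) * sqrt_log_inv (m i))
      = (\<Sum>i<n. ennreal ((1 / r) ^ i * sqrt (ln (1 / m i))))"
  proof (intro sum.cong refl)
    fix i
    have "m i \<noteq> 0" using m[of i] by simp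
    then show "ennreal (r powr (- real i)) * sqrt_log_inv (m i)
        = ennreal ((1 / r) ^ i * sqrt (ln (1 / m i)))"
      using r m[of i] by (simp add: sqrt_log_inv_def powr_minus powr_realpow power_one_over
          inverse_eq_divide ennreal_mult[symmetric])
  qed
  also have "\<dots> = ennreal (\<Sum>i<n. (1 / r) ^ i * sqrt (ln (1 / m i)))"
    using r m by (intro sum_ennreal) auto
  also have "\<dots> \<le> ennreal K" by (intro ennreal_leI bound)
  finally show "(\<Sum>i<n. ennreal (r powr (- real i)) * sqrt_log_inv (m i)) \<le> ennreal K" .
qed (rule summableI)

section \<open>Transfer of the labels from \<open>U\<close> to \<open>T\<close>, and
  assembly\<close>

theorem proposition4p4:
  shows "\<exists>(K::real) (Kp::real \<Rightarrow> real).
    \<forall>(p::real) (r::real) (\<gamma>::real) (N::nat) (T::(nat \<Rightarrow> real) set) (U::(nat \<Rightarrow> real) set).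
      1 \<le> p \<and> p < 2 \<and> 4 \<le> r \<and> \<gamma> = 1 / (2 - p) \<and> 1 \<le> N \<and>
      T \<subseteq> RN N \<and> T \<noteq> {} \<and> U \<subseteq> RN N \<and>
      gamma_half N U \<le> 1 \<and> T \<subseteq> set_sum N U (weak_Lp_ball N p)
      \<longrightarrow> (\<exists>(\<C>::nat \<Rightarrow> (nat \<Rightarrow> real) set set) (\<mu>::(nat \<Rightarrow> real) measure).
            increasing_partitions T \<C> \<and>
            prob_measure_on N T \<mu> \<and>
            (\<forall>i. \<C> i \<subseteq> sets \<mu>) \<and>
            (\<forall>i. \<forall>C\<in>\<C> i. trunc_diam N r \<gamma> i C \<le> ennreal (Kp p * r powr (- real i))) \<and>
            (\<forall>x\<in>T. (\<Sum>i. ennreal (r powr (- real i)) * sqrt_log_inv (measure \<mu> (cell (\<C> i) x)))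
                      \<le> ennreal K))"
proof -
  \<comment> \<open>The 4 is the diameter factor of a label class in \<open>U\<close>; the other
    term comes from the two weak components.\<close>
  define Kp :: "real \<Rightarrow> real" where "Kp p = 4 + 2 * sqrt (4 / (1 - 2 powr (p - 2)))" for p
  show ?thesis
  proof (rule exI[of _ "4/3 * (4/3 + 8)"], rule exI[of _ Kp], intro allI impI)
    fix p r \<gamma> :: real and N :: nat and T U :: "(nat \<Rightarrow> real) set"
    assume asm: "1 \<le> p \<and> p < 2 \<and> 4 \<le> r \<and> \<gamma> = 1 / (2 - p) \<and> 1 \<le> N \<and>
      T \<subseteq> RN N \<and> T \<noteq> {} \<and> U \<subseteq> RN N \<and>
      gamma_half N U \<le> 1 \<and> T \<subseteq> set_sum N U (weak_Lp_ball N p)"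
    then have p: "1 \<le> p" "p < 2" and r: "4 \<le> r" and \<gamma>: "\<gamma> = 1 / (2 - p)"
      and T: "T \<subseteq> RN N" "T \<noteq> {}" and U: "U \<subseteq> RN N"
      and gam: "gamma_half N U \<le> 1" and TU: "T \<subseteq> set_sum N U (weak_Lp_ball N p)" by auto
    define z where "z = 1 / r"
    have r0: "0 < r" and z: "0 < z" "z \<le> 1/4" using r by (auto simp: z_def field_simps)
    have z_pow: "z ^ i = r powr (- real i)" for i
      using r0 by (simp add: z_def powr_minus powr_realpow power_one_over inverse_eq_divide)

    have "\<forall>f\<in>T. \<exists>uv. fst uv \<in> U \<and> snd uv \<in> weak_Lp_ball N p \<and> (\<forall>k\<in>{1..N}. f k = fst uv k + snd uv k)"
      using TU by (fastforce simp: set_sum_def)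
    then obtain uv where uv: "\<And>f. f \<in> T \<Longrightarrow> fst (uv f) \<in> U"
        "\<And>f. f \<in> T \<Longrightarrow> snd (uv f) \<in> weak_Lp_ball N p"
        "\<And>f k. f \<in> T \<Longrightarrow> k \<in> {1..N} \<Longrightarrow> f k = fst (uv f) k + snd (uv f) k"
      by (metis (no_types, lifting))

    \<comment> \<open>The infimum need not be attained; the slack between 1 and 2 provides an actual
      measure \<open>M\<close> with all entropy integrals at most 2.\<close>
    have "gamma_half N U < 2" using gam by (rule le_less_trans) simp
    then obtain M where M: "prob_measure_on N U M"
      and sup: "(SUP x\<in>U. \<integral>\<^sup>+e\<in>{0..}. sqrt_log_inv (measure M (Lball N U x e)) \<partial>lborel) < 2"
      unfolding gamma_half_def Lball_def INF_less_iff by auto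
    have int: "(\<integral>\<^sup>+e\<in>{0..}. sqrt_log_inv (measure M (Lball N U x e)) \<partial>lborel) \<le> ennreal 2"
      if "x \<in> U" for x
      using order_trans[OF SUP_upper[OF that] less_imp_le[OF sup]] by simp
    note ball_pos = entropy_integral_bounds(1)[OF M U int _ z, simplified]
    have ball_sum: "(\<Sum>i<n. z ^ i * sqrt (ln (1 / measure M (Lball N U x (z ^ i))))) \<le> 8/3"
      if "x \<in> U" for x n
      using entropy_integral_bounds(2)[OF M U int[OF that] _ z] by simp
    interpret prob_space M using M by (simp add: prob_measure_on_def)
    have "\<exists>(c :: (nat \<Rightarrow> real) \<Rightarrow> nat \<Rightarrow> real) (q :: (nat \<Rightarrow> real) pmf). \<forall>x\<in>U. c x \<in> U \<and>
        Lball N U x (z ^ i) \<inter> Lball N U (c x) (z ^ i) \<noteq> {} \<and>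
        (prob (Lball N U x (z ^ i)))\<^sup>2 / 4 \<le> pmf q (c x)" for i
      using Lball_measurable[OF M U] ball_pos z by (intro weighted_centres) auto
    then obtain c :: "nat \<Rightarrow> (nat \<Rightarrow> real) \<Rightarrow> nat \<Rightarrow> real" and q :: "nat \<Rightarrow> (nat \<Rightarrow> real) pmf"
      where c: "\<And>i x. x \<in> U \<Longrightarrow> Lball N U x (z ^ i) \<inter> Lball N U (c i x) (z ^ i) \<noteq> {}"
        and q: "\<And>i x. x \<in> U \<Longrightarrow> (prob (Lball N U x (z ^ i)))\<^sup>2 / 4 \<le> pmf (q i) (c i x)"
      by metis
    \<comment> \<open>Intersecting balls of radius \<open>z ^ i\<close> have centres within twice
      that radius; two points sharing a centre are then within four times it.\<close>
    have c_dist: "L2_set (\<lambda>k. x k - c i x k) {1..N} \<le> 2 * z ^ i" if x: "x \<in> U" for i x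
    proof -
      obtain y where y: "y \<in> Lball N U x (z ^ i)" "y \<in> Lball N U (c i x) (z ^ i)"
        using c[OF x] by blast
      have "L2_set (\<lambda>k. x k - c i x k) {1..N} = L2_set (\<lambda>k. (x k - y k) + - (c i x k - y k)) {1..N}"
        by simp
      also have "\<dots> \<le> L2_set (\<lambda>k. x k - y k) {1..N} + L2_set (\<lambda>k. - (c i x k - y k)) {1..N}"
        by (rule L2_set_triangle_ineq)
      also have "L2_set (\<lambda>k. - (c i x k - y k)) {1..N} = L2_set (\<lambda>k. c i x k - y k) {1..N}"
        by (simp add: L2_set_def power2_commute)
      finally show ?thesis using y by (simp add: Lball_def)
    qed
    have c_close: "L2_set (\<lambda>k. x k - y k) {1..N} \<le> 4 * z ^ i"
      if xy: "x \<in> U" "y \<in> U" "c i x = c i y" for i x y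
    proof -
      have "L2_set (\<lambda>k. x k - y k) {1..N} = L2_set (\<lambda>k. (x k - c i x k) + - (y k - c i y k)) {1..N}"
        using xy by simp
      also have "\<dots> \<le> L2_set (\<lambda>k. x k - c i x k) {1..N} + L2_set (\<lambda>k. - (y k - c i y k)) {1..N}"
        by (rule L2_set_triangle_ineq)
      also have "L2_set (\<lambda>k. - (y k - c i y k)) {1..N} = L2_set (\<lambda>k. y k - c i y k) {1..N}"
        by (simp add: L2_set_def power2_commute)
      finally show ?thesis using c_dist[OF xy(1), of i] c_dist[OF xy(2), of i] by simp
    qed

    \<comment> \<open>Points of \<open>T\<close> inherit the label of the \<open>U\<close> component
      in a decomposition fixed once for all scales.\<close>
    define l where "l i f = c i (fst (uv f))" for i f
    have l_pos: "0 < pmf (q i) (l i f)" if "f \<in> T" for i f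
    proof -
      have "0 < (prob (Lball N U (fst (uv f)) (z ^ i)))\<^sup>2 / 4"
        using ball_pos[OF uv(1)[OF that], of "z ^ i"] z by simp
      then show ?thesis using q[OF uv(1)[OF that], of i] unfolding l_def by linarith
    qed
    have l_sum: "(\<Sum>i<n. z ^ i * sqrt (ln (1 / pmf (q i) (l i f)))) \<le> 8" if f: "f \<in> T" for n f
    proof -
      let ?x = "fst (uv f)"
      have "(\<Sum>i<n. z ^ i * sqrt (ln (1 / pmf (q i) (l i f))))
          \<le> (\<Sum>i<n. z ^ i * (2 + 2 * sqrt (ln (1 / prob (Lball N U ?x (z ^ i))))))"
        unfolding l_def using z ball_pos[OF uv(1)[OF f]] q[OF uv(1)[OF f]]
        by (intro sum_mono mult_left_mono sqrt_ln_inv_square_le) auto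
      also have "\<dots> = 2 * (\<Sum>i<n. z ^ i) + 2 * (\<Sum>i<n. z ^ i * sqrt (ln (1 / prob (Lball N U ?x (z ^ i)))))"
        by (simp add: sum.distrib sum_distrib_left algebra_simps)
      also have "\<dots> \<le> 2 * (4/3) + 2 * (8/3)"
        using sum_power_le[of z n] z ball_sum[OF uv(1)[OF f], of n] by simp
      finally show ?thesis by simp
    qed
    obtain \<C> \<nu> where inc: "increasing_partitions T \<C>" and \<nu>: "set_pmf \<nu> \<subseteq> T"
      and lab': "\<forall>i. \<forall>C\<in>\<C> i. \<forall>f\<in>C. \<forall>g\<in>C. l i f = l i g"
      and cell_pos: "\<forall>i. \<forall>f\<in>T. 0 < measure_pmf.prob \<nu> (cell (\<C> i) f)"
      and cell_sum: "\<forall>n. \<forall>f\<in>T.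
        (\<Sum>i<n. z ^ i * sqrt (ln (1 / measure_pmf.prob \<nu> (cell (\<C> i) f)))) \<le> 4/3 * (4/3 + 8)"
      by (atomize_elim, rule partitions_of_labels[OF T(2) less_imp_le[OF z(1)] z(2) l_pos l_sum])
    have lab: "l i f = l i g" if "C \<in> \<C> i" "f \<in> C" "g \<in> C" for i C f g
      using lab' that by blast
    have sub: "C \<subseteq> T" if "C \<in> \<C> i" for C i
      using that inc unfolding increasing_partitions_def partition_on_def by blast
    have cell_in: "cell (\<C> i) f \<in> \<C> i" if "f \<in> T" for i f
    proof -
      have part: "partition_on T (\<C> i)" using inc by (simp add: increasing_partitions_def)
      have "f \<in> \<Union> (\<C> i)" using that partition_onD1[OF part] by simp
      then obtain C where C: "C \<in> \<C> i" "f \<in> C" by blast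
      have "cell (\<C> i) f = C"
        unfolding cell_def using C disjointD[OF partition_onD2[OF part]]
        by (intro the_equality) blast+
      then show ?thesis using C by simp
    qed

    \<comment> \<open>Every subset of \<open>T\<close> is measurable for this discrete measure,
      which covers both the trace Borel sets and the cells.\<close>
    define \<mu> where "\<mu> = restrict_space (measure_pmf \<nu>) T"
    have \<mu>_sets: "sets \<mu> = Pow T" by (auto simp: \<mu>_def sets_restrict_space)
    have \<mu>_measure: "measure \<mu> C = measure_pmf.prob \<nu> C" if "C \<subseteq> T" for C
      unfolding \<mu>_def using that by (intro measure_restrict_space) auto
    have "emeasure (measure_pmf \<nu>) T = 1"
      using \<nu> by (subst measure_pmf.emeasure_eq_1_AE) (auto simp: AE_measure_pmf_iff)
    then have "prob_space \<mu>" unfolding \<mu>_def by (intro prob_space_restrict_space) auto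
    moreover have "space \<mu> = T" by (simp add: \<mu>_def space_restrict_space)
    ultimately have "prob_measure_on N T \<mu>"
      unfolding prob_measure_on_def \<mu>_sets by (auto simp: sets_restrict_space)
    moreover have "\<C> i \<subseteq> sets \<mu>" for i using sub by (auto simp: \<mu>_sets)
    moreover have "trunc_diam N r \<gamma> i C \<le> ennreal (Kp p * r powr (- real i))"
      if C: "C \<in> \<C> i" for i C
      unfolding trunc_diam_def
    proof (intro SUP_least ennreal_leI)
      fix f g assume fg: "f \<in> C" "g \<in> C"
      then have fgT: "f \<in> T" "g \<in> T" using sub[OF C] by auto
      have "trunc_dist N r \<gamma> i f g \<le> L2_set (\<lambda>k. fst (uv f) k - fst (uv g) k) {1..N}
          + 2 * sqrt (4 / (1 - 2 powr (p - 2))) * r powr (- real i)"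
        using uv fgT by (intro trunc_dist_decomposition p r0 \<gamma>) auto
      also have "L2_set (\<lambda>k. fst (uv f) k - fst (uv g) k) {1..N} \<le> 4 * z ^ i"
        using lab[OF C fg] uv fgT unfolding l_def by (intro c_close) auto
      finally show "trunc_dist N r \<gamma> i f g \<le> Kp p * r powr (- real i)"
        by (simp add: Kp_def z_pow algebra_simps)
    qed
    moreover have "(\<Sum>i. ennreal (r powr (- real i)) * sqrt_log_inv (measure \<mu> (cell (\<C> i) f)))
        \<le> ennreal (4/3 * (4/3 + 8))" if f: "f \<in> T" for f
      unfolding \<mu>_measure[OF sub[OF cell_in[OF f]]]
      using cell_pos cell_sum f unfolding z_def
      by (intro suminf_sqrt_log_inv_le r0) (auto simp only: measure_pmf.prob_le_1)
    ultimately show "\<exists>\<C> \<mu>. increasing_partitions T \<C> \<and>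
            prob_measure_on N T \<mu> \<and>
            (\<forall>i. \<C> i \<subseteq> sets \<mu>) \<and>
            (\<forall>i. \<forall>C\<in>\<C> i. trunc_diam N r \<gamma> i C \<le> ennreal (Kp p * r powr (- real i))) \<and>
            (\<forall>x\<in>T. (\<Sum>i. ennreal (r powr (- real i)) * sqrt_log_inv (measure \<mu> (cell (\<C> i) x)))
                      \<le> ennreal (4/3 * (4/3 + 8)))"
      using inc by blast
  qed
qed

end
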